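(* For every integer $m\ge 4$, $$F(m)\le\left\lfloor\frac{3m^2-12m+16\left\lfloor \frac{2m}{3}\right\rfloor}{6}\right\rfloor.$$ Consequently, for every integer $m\ge 4$, $$F(m)\le \frac12 m^2-\frac{2m}{9}.$$
   Context: For an integer $m\ge 2$, the grid is $G_m=\{1,\dots,m\}\times\{1,\dots,m\}$; its elements are called squares, and $(i,j)$ is the square in row $i$ and column $j$. For integers $1\le a,b\le m-1$, the card $C_{a,b}$ is the set $\{(a,b),(a+1,b),(a,b+1),(a+1,b+1)\}$, and $\mathcal C_m=\{C_{a,b}:1\le a,b\le m-1\}$. A configuration is a non-empty subset $U\subseteq\mathcal C_m$. The multiplicity of $x\in G_m$ is $\mu(x)=|\{C\in U: x\in C\}|$. A square $x$ is private for $C\in U$ if $x\in C$ and $\mu(x)=1$. $U$ is an irredundant cover of $G_m$ if $\mu(x)\ge 1$ for every $x\in G_m$ and every $C\in U$ contains at least one private square. $F(m)=\max\{|U|: U\subseteq\mathcal C_m\text{ is an irredundant cover of }G_m\}$. *)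

theory Defs
  imports Complex_Main
begin

text \<open>A square is a pair (row, column).\<close>

type_synonym square = "nat \<times> nat"

definition grid :: "nat \<Rightarrow> square set" where
  "grid m = {1..m} \<times> {1..m}"

text \<open>A card is a 2 by 2 block of squares, unrelated to the cardinality function \<open>card\<close>.\<close>

definition block_card :: "nat \<Rightarrow> nat \<Rightarrow> square set" where
  "block_card a b = {(a, b), (a + 1, b), (a, b + 1), (a + 1, b + 1)}"

definition all_cards :: "nat \<Rightarrow> square set set" where
  "all_cards m = {block_card a b | a b. 1 \<le> a \<and> a \<le> m - 1 \<and> 1 \<le> b \<and> b \<le> m - 1}"

definition configuration :: "nat \<Rightarrow> square set set \<Rightarrow> bool" where
  "configuration m U \<longleftrightarrow> U \<noteq> {} \<and> U \<subseteq> all_cards m"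

definition multiplicity :: "square set set \<Rightarrow> square \<Rightarrow> nat" where
  "multiplicity U x = card {C \<in> U. x \<in> C}"

definition private_square :: "square set set \<Rightarrow> square set \<Rightarrow> square \<Rightarrow> bool" where
  "private_square U C x \<longleftrightarrow> x \<in> C \<and> multiplicity U x = 1"

definition irredundant_cover :: "nat \<Rightarrow> square set set \<Rightarrow> bool" where
  "irredundant_cover m U \<longleftrightarrow> configuration m U \<and>
     (\<forall>x \<in> grid m. multiplicity U x \<ge> 1) \<and>
     (\<forall>C \<in> U. \<exists>x. private_square U C x)"

definition max_cover_size :: "nat \<Rightarrow> nat" where
  "max_cover_size m = Max {card U | U. irredundant_cover m U}"

text \<open>\<open>Max\<close> is unspecified on empty and infinite sets. For \<open>m \<ge> 2\<close> the set in the
  definition of \<open>max_cover_size\<close> is neither, so \<open>max_cover_size m\<close> is a maximum that is attained.\<close>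

lemma finite_all_cards: "finite (all_cards m)"
proof (rule finite_subset)
  show "all_cards m \<subseteq> (\<lambda>(a, b). block_card a b) ` ({..m} \<times> {..m})"
  proof
    fix C assume "C \<in> all_cards m"
    then obtain a b where "C = block_card a b" "a \<le> m - 1" "b \<le> m - 1"
      unfolding all_cards_def by blast
    then show "C \<in> (\<lambda>(a, b). block_card a b) ` ({..m} \<times> {..m})"
      by (intro image_eqI[of _ _ "(a, b)"]) auto
  qed
qed auto

lemma finite_cover_sizes: "finite {card U | U. irredundant_cover m U}"
proof (rule finite_subset)
  show "{card U | U. irredundant_cover m U} \<subseteq> card ` Pow (all_cards m)"
    by (auto simp: irredundant_cover_def configuration_def)
qed (use finite_all_cards in auto)

lemma all_cards_cover:
  assumes "m \<ge> 2" "x \<in> grid m"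
  shows "\<exists>C \<in> all_cards m. x \<in> C"
proof -
  obtain i j where x: "x = (i, j)" "1 \<le> i" "i \<le> m" "1 \<le> j" "j \<le> m"
    using assms(2) by (auto simp: grid_def)
  have "1 \<le> min i (m - 1)" "min i (m - 1) \<le> m - 1" "1 \<le> min j (m - 1)" "min j (m - 1) \<le> m - 1"
    using x assms(1) by auto
  then have "block_card (min i (m - 1)) (min j (m - 1)) \<in> all_cards m"
    unfolding all_cards_def by blast
  moreover have "x \<in> block_card (min i (m - 1)) (min j (m - 1))"
    using x assms(1) by (auto simp: block_card_def min_def)
  ultimately show ?thesis by blast
qed

lemma irredundant_cover_exists:
  assumes "m \<ge> 2"
  shows "\<exists>U. irredundant_cover m U"
proof -
  define P where "P U \<longleftrightarrow> U \<subseteq> all_cards m \<and> (\<forall>x \<in> grid m. \<exists>C \<in> U. x \<in> C)" for U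
  have "P (all_cards m)" using all_cards_cover[OF assms] by (simp add: P_def)
  then obtain U where PU: "P U" and min: "\<And>V. P V \<Longrightarrow> card U \<le> card V"
    using ex_has_least_nat[of P "all_cards m" card] by metis
  have sub: "U \<subseteq> all_cards m" and cov: "\<And>x. x \<in> grid m \<Longrightarrow> \<exists>C \<in> U. x \<in> C"
    using PU by (simp_all add: P_def)
  have fin: "finite U" using sub finite_all_cards by (rule finite_subset)
  have "(1, 1) \<in> grid m" using assms by (simp add: grid_def)
  then have "U \<noteq> {}" using cov by fast
  moreover have "multiplicity U x \<ge> 1" if "x \<in> grid m" for x
  proof -
    have "{C \<in> U. x \<in> C} \<noteq> {}" using cov[OF that] by auto
    then have "card {C \<in> U. x \<in> C} > 0" using fin by (simp add: card_gt_0_iff)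
    then show ?thesis by (simp add: multiplicity_def)
  qed
  moreover have "\<exists>x. private_square U C x" if C: "C \<in> U" for C
  proof -
    have "card (U - {C}) < card U" using fin C by (rule card_Diff1_less)
    then have "\<not> P (U - {C})" using min[of "U - {C}"] by linarith
    moreover have "U - {C} \<subseteq> all_cards m" using sub by (rule order_trans[OF Diff_subset])
    ultimately obtain x where x: "x \<in> grid m" "\<forall>D \<in> U - {C}. x \<notin> D"
      unfolding P_def by meson
    obtain D where D: "D \<in> U" "x \<in> D" using cov[OF x(1)] by (rule bexE)
    then have "D = C" using x(2) by (cases "D = C") simp_all
    then have "{E \<in> U. x \<in> E} = {C}" using D x(2) by fastforce
    then have "private_square U C x"
      using D \<open>D = C\<close> by (simp add: private_square_def multiplicity_def)
    then show ?thesis ..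
  qed
  ultimately show ?thesis
    using sub unfolding irredundant_cover_def configuration_def by meson
qed

lemma max_cover_size_attained:
  assumes "m \<ge> 2"
  shows "\<exists>U. irredundant_cover m U \<and> card U = max_cover_size m"
proof -
  have "max_cover_size m \<in> {card U | U. irredundant_cover m U}"
    unfolding max_cover_size_def using irredundant_cover_exists[OF assms] by (intro Max_in finite_cover_sizes) blast
  then show ?thesis by force
qed

end

theory Submission
  imports Defs
begin

text \<open>
  Identify a card with its upper left square, so that a configuration becomes a set \<open>T\<close> of
  positions in a \<open>k\<close> by \<open>k\<close> array with \<open>k = m - 1\<close>. The multiplicity of a square is then the
  number of elements of \<open>T\<close> in a 2 by 2 window, and irredundance says that every element of \<open>T\<close>
  is alone in one of the four windows that contain it. The bound comes from counting the
  incidences between elements of \<open>T\<close> and the \<open>(k - 1)\<^sup>2\<close> windows that lie inside the array.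
  Let \<open>n\<close> be the number of elements of \<open>T\<close>, and \<open>N\<close> the number of those on the boundary.

  \<^item> From below: since the four corner positions belong to \<open>T\<close>, every element lies in four
    inner windows except that a boundary element lies in two and a corner in one. There are
    \<open>4 n - 2 N - 4\<close> incidences.

  \<^item> From above: let \<open>w c\<close> be the number of inner windows containing exactly \<open>c\<close> elements. As
    \<open>c \<le> 3 - 2 [c = 1] - [c = 2] + [c = 4]\<close>, there are at most
    \<open>3 (k - 1)\<^sup>2 - 2 w 1 - w 2 + w 4\<close> incidences. Each of the \<open>n - N\<close> elements off the boundary is
    alone in an inner window, so \<open>w 1 \<ge> n - N\<close> (\<open>card_inner_cells_le\<close>). A full window is
    surrounded by empty positions, because each of its elements can only be alone in the window
    touching the block at that corner; hence the windows one step above and below a full one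
    contain two elements, and \<open>w 4 \<le> w 2\<close> (\<open>card_full_windows_le\<close>).

  Together, \<open>6 n \<le> 3 (k - 1)\<^sup>2 + 4 + 4 N\<close>. Finally, no three consecutive positions of a line belong
  to \<open>T\<close>, since the middle one could not be alone in a window. So a line contains at most
  \<open>\<lfloor>2 m / 3\<rfloor>\<close> elements (\<open>line_bound\<close>), and \<open>N \<le> 4 \<lfloor>2 m / 3\<rfloor> - 4\<close>, each corner being shared by two
  sides. This gives \<open>6 n \<le> 3 m\<^sup>2 - 12 m + 16 \<lfloor>2 m / 3\<rfloor>\<close>; dropping the floor gives the second bound.
\<close>

section \<open>Irredundant sets of positions\<close>

definition occupied :: "(nat \<times> nat) set \<Rightarrow> nat \<Rightarrow> nat \<Rightarrow> int" where
  "occupied T i j = of_bool ((i, j) \<in> T)"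

text \<open>
  The window \<open>(i, j)\<close> has \<open>(i, j)\<close> as its upper left position and corresponds to the square
  \<open>(i + 1, j + 1)\<close>. Row and column \<open>0\<close> contain no positions of cards; they serve the windows of
  the squares in the first row and column.
\<close>

definition occupancy :: "(nat \<times> nat) set \<Rightarrow> nat \<Rightarrow> nat \<Rightarrow> int" where
  "occupancy T i j = occupied T i j + occupied T (Suc i) j
     + occupied T i (Suc j) + occupied T (Suc i) (Suc j)"

definition irredundant :: "(nat \<times> nat) set \<Rightarrow> bool" where
  "irredundant T \<longleftrightarrow> (\<forall>a b. (a, b) \<in> T \<longrightarrow>
     (\<exists>i j. a \<in> {i, Suc i} \<and> b \<in> {j, Suc j} \<and> occupancy T i j = 1))"

lemma occupancy_converse: "occupancy (T\<inverse>) i j = occupancy T j i"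
  by (simp add: occupancy_def occupied_def)

lemma irredundant_converse: "irredundant T \<Longrightarrow> irredundant (T\<inverse>)"
  unfolding irredundant_def occupancy_converse by blast

lemma occupancy_one_unique:
  assumes "occupancy T i j = 1"
    and "(a, b) \<in> T" "a \<in> {i, Suc i}" "b \<in> {j, Suc j}"
    and "(c, d) \<in> T" "c \<in> {i, Suc i}" "d \<in> {j, Suc j}"
  shows "a = c \<and> b = d"
proof -
  have "occupied T i j + occupied T (Suc i) j + occupied T i (Suc j) + occupied T (Suc i) (Suc j) = 1"
    using assms(1) by (simp add: occupancy_def)
  moreover have "occupied T a b = 1" "occupied T c d = 1"
    using assms by (simp_all add: occupied_def)
  moreover have "occupied T i' j' \<ge> 0" for i' j' by (simp add: occupied_def)
  note this[of i j] this[of "Suc i" j] this[of i "Suc j"] this[of "Suc i" "Suc j"]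
  ultimately show ?thesis using assms(3,4,6,7) by (elim insertE emptyE) simp_all
qed

lemma occupancy_four_iff:
  "occupancy T i j = 4 \<longleftrightarrow>
     (i, j) \<in> T \<and> (Suc i, j) \<in> T \<and> (i, Suc j) \<in> T \<and> (Suc i, Suc j) \<in> T"
  by (simp add: occupancy_def occupied_def of_bool_def)

lemma irredundantE:
  assumes "irredundant T" "(a, b) \<in> T"
  obtains i j where "a \<in> {i, Suc i}" "b \<in> {j, Suc j}"
    "\<And>c d. (c, d) \<in> T \<Longrightarrow> c \<in> {i, Suc i} \<Longrightarrow> d \<in> {j, Suc j} \<Longrightarrow> c = a \<and> d = b"
proof -
  obtain i j where "a \<in> {i, Suc i}" "b \<in> {j, Suc j}" "occupancy T i j = 1"
    using assms unfolding irredundant_def by blast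
  then show thesis using occupancy_one_unique[of T i j] assms(2) by (intro that[of i j]) blast+
qed

text \<open>Every window containing the middle position contains one of its two neighbours.\<close>

lemma irredundant_no_three:
  assumes "irredundant T" "(i, j) \<in> T" "(i, Suc j) \<in> T" "(i, Suc (Suc j)) \<in> T"
  shows False
proof -
  obtain i' j' where "i \<in> {i', Suc i'}" "Suc j \<in> {j', Suc j'}"
    and "\<And>c d. (c, d) \<in> T \<Longrightarrow> c \<in> {i', Suc i'} \<Longrightarrow> d \<in> {j', Suc j'} \<Longrightarrow> c = i \<and> d = Suc j"
    using irredundantE[OF assms(1,3)] by blast
  from this(1,2) this(3)[OF assms(2)] this(3)[OF assms(4)] show False by auto
qed

lemma sum_overlapping_triples:
  fixes f :: "nat \<Rightarrow> int"
  shows "(\<Sum>j<k. f j + f (Suc j) + f (Suc (Suc j)))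
    = 3 * (\<Sum>j=1..k. f j) + f 0 - f 1 - f k + f (Suc k)"
  by (induction k) auto

text \<open>
  Every three consecutive positions contain at most two elements. The triples that reach one
  position beyond either end of the line are included, so that almost every position is counted
  three times.
\<close>

lemma line_bound:
  fixes k :: nat
  assumes irr: "irredundant T" and sub: "T \<subseteq> {1..k} \<times> {1..k}"
  shows "3 * (\<Sum>j=1..k. occupied T i j) \<le> 2 * int (Suc k)"
proof -
  have "occupied T i j + occupied T i (Suc j) + occupied T i (Suc (Suc j)) \<le> 2" for j
    using irredundant_no_three[OF irr, of i j] by (auto simp: occupied_def)
  then have "(\<Sum>j<k. occupied T i j + occupied T i (Suc j) + occupied T i (Suc (Suc j)))
      \<le> (\<Sum>j<k. 2)"
    by (intro sum_mono) auto
  moreover have "occupied T i 0 = 0" "occupied T i (Suc k) = 0"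
    using sub by (auto simp: occupied_def)
  moreover have "occupied T i 1 \<le> 1" "occupied T i k \<le> 1"
    by (auto simp: occupied_def)
  ultimately show ?thesis unfolding sum_overlapping_triples by simp
qed

text \<open>
  The position vertically adjacent to \<open>(a, b)\<close> outside a full window is empty: of the four windows
  containing \<open>(a, b)\<close>, two contain the other element of the block in column \<open>b\<close>, and the two
  remaining ones contain the position in question.
\<close>

lemma full_window_surrounding:
  assumes irr: "irredundant T"
    and full: "a \<in> {i, Suc i}" "b \<in> {j, Suc j}" "occupancy T i j = 4"
    and near: "c \<in> {a, Suc a} \<or> a = Suc c" "c \<notin> {i, Suc i}"
  shows "(c, b) \<notin> T"
proof
  assume out: "(c, b) \<in> T"
  \<comment> \<open>The other row of the block.\<close>
  define a' where "a' = i + Suc i - a"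
  have in_T: "(a, b) \<in> T" "(a', b) \<in> T"
    using full by (elim insertE emptyE; simp add: occupancy_four_iff a'_def)+
  have other: "a' \<noteq> a" "c \<noteq> a" using full(1) near(2) by (auto simp: a'_def)
  obtain u v where u: "a \<in> {u, Suc u}" "b \<in> {v, Suc v}"
    and sole: "\<And>c d. (c, d) \<in> T \<Longrightarrow> c \<in> {u, Suc u} \<Longrightarrow> d \<in> {v, Suc v} \<Longrightarrow> c = a \<and> d = b"
    using irredundantE[OF irr in_T(1)] by blast
  have "a' \<notin> {u, Suc u}" "c \<notin> {u, Suc u}"
    using sole[OF in_T(2)] sole[OF out] u(2) other by blast+
  moreover have "a' = Suc a \<and> a = Suc c \<or> a = Suc a' \<and> c = Suc a"
    using full(1) near by (auto simp: a'_def)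
  ultimately show False using u(1) by auto
qed

lemma full_window_isolated_below:
  assumes irr: "irredundant T" and full: "occupancy T i j = 4"
  shows "(Suc (Suc i), j) \<notin> T" "(Suc (Suc i), Suc j) \<notin> T"
  using full_window_surrounding[OF irr _ _ full, of "Suc i" _ "Suc (Suc i)"] by simp_all

lemma full_window_isolated_above:
  assumes irr: "irredundant T" and full: "occupancy T (Suc i) j = 4"
  shows "(i, j) \<notin> T" "(i, Suc j) \<notin> T"
  using full_window_surrounding[OF irr _ _ full, of "Suc i" _ i] by simp_all

section \<open>Counting the inner windows\<close>

definition inner_windows :: "(nat \<times> nat) set \<Rightarrow> nat \<Rightarrow> int \<Rightarrow> (nat \<times> nat) set" where
  "inner_windows T k c = {(i, j). i \<in> {1..<k} \<and> j \<in> {1..<k} \<and> occupancy T i j = c}"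

lemma finite_inner_windows: "finite (inner_windows T k c)"
  by (rule finite_subset[of _ "{1..<k} \<times> {1..<k}"]) (auto simp: inner_windows_def)

text \<open>
  A full window is matched with the window just above it, or just below if the one above is not
  an inner window. Only the windows starting in rows \<open>1\<close> and \<open>3\<close> of a column could be matched with
  the same window; they cannot both be full, as they would be adjacent blocks. The hypothesis
  \<open>k \<ge> 3\<close> makes the window below row \<open>1\<close> an inner one.
\<close>

lemma card_full_windows_le:
  assumes irr: "irredundant T" and k: "k \<ge> 3"
  shows "card (inner_windows T k 4) \<le> card (inner_windows T k 2)"
proof (rule card_inj_on_le)
  let ?f = "\<lambda>(i, j). (if i = 1 then 2 else i - 1, j) :: nat \<times> nat"
  have no_stack: False if "occupancy T 1 j = 4" "occupancy T 3 j = 4" for j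
    using full_window_isolated_below[OF irr that(1)] that(2)
    by (simp add: occupancy_four_iff numeral_3_eq_3)
  show "inj_on ?f (inner_windows T k 4)"
  proof (rule inj_onI)
    fix w w'
    assume w: "w \<in> inner_windows T k 4" "w' \<in> inner_windows T k 4" "?f w = ?f w'"
    obtain i j i' j' where ij: "w = (i, j)" "w' = (i', j')" by (metis surj_pair)
    have mem: "(i, j) \<in> inner_windows T k 4" "(i', j') \<in> inner_windows T k 4"
      and eq: "(if i = 1 then 2 else i - 1, j) = (if i' = 1 then 2 else i' - 1, j')"
      using w unfolding ij by simp_all
    have "j = j'" using eq by simp
    moreover have "i = i' \<or> (i = 1 \<and> i' = 3) \<or> (i = 3 \<and> i' = 1)"
      using eq mem by (auto simp: inner_windows_def split: if_splits)
    ultimately show "w = w'"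
      using mem no_stack[of j] ij by (auto simp: inner_windows_def)
  qed
  show "?f ` inner_windows T k 4 \<subseteq> inner_windows T k 2"
  proof clarify
    fix i j assume mem: "(i, j) \<in> inner_windows T k 4"
    then have full: "occupancy T i j = 4" and i: "1 \<le> i" "i < k" and j: "j \<in> {1..<k}"
      by (auto simp: inner_windows_def)
    have in_T: "(i, j) \<in> T" "(Suc i, j) \<in> T" "(i, Suc j) \<in> T" "(Suc i, Suc j) \<in> T"
      using full by (simp_all add: occupancy_four_iff)
    show "(if i = 1 then 2 else i - 1, j) \<in> inner_windows T k 2"
    proof (cases "i = 1")
      case True
      then show ?thesis
        using full_window_isolated_below[OF irr full] in_T k j
        by (auto simp: inner_windows_def occupancy_def occupied_def numeral_2_eq_2)
    next
      case False
      then obtain i' where "i = Suc i'" "i' \<ge> 1" using i(1) by (cases i) auto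
      then show ?thesis
        using full_window_isolated_above[OF irr, of i' j] full in_T i j
        by (auto simp: inner_windows_def occupancy_def occupied_def)
    qed
  qed
qed (rule finite_inner_windows)

text \<open>
  All four windows containing a position off the boundary are inner windows, and two different
  elements cannot be alone in the same window.
\<close>

lemma card_inner_cells_le:
  assumes irr: "irredundant T"
  shows "card (T \<inter> {2..<k} \<times> {2..<k}) \<le> card (inner_windows T k 1)"
proof -
  define good where "good = (\<lambda>(a, b) (i, j). a \<in> {i, Suc i} \<and> b \<in> {j, Suc j} \<and> occupancy T i j = 1)"
  have "\<forall>c\<in>T. \<exists>w. good c w"
    using irr unfolding irredundant_def good_def by fastforce
  then obtain p where p: "\<And>c. c \<in> T \<Longrightarrow> good c (p c)" by metis
  have unique: "c = c'" if "good c w" "good c' w" "c \<in> T" "c' \<in> T" for c c' w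
  proof -
    obtain a b a' b' i j where "c = (a, b)" "c' = (a', b')" "w = (i, j)"
      by (metis surj_pair)
    then show ?thesis
      using that occupancy_one_unique[of T i j a b a' b'] by (simp add: good_def)
  qed
  have "inj_on p (T \<inter> {2..<k} \<times> {2..<k})"
    using p unique by (intro inj_onI) (metis IntD1)
  moreover have "p ` (T \<inter> {2..<k} \<times> {2..<k}) \<subseteq> inner_windows T k 1"
  proof (rule image_subsetI)
    fix c assume c: "c \<in> T \<inter> {2..<k} \<times> {2..<k}"
    obtain a b i j where "c = (a, b)" "p c = (i, j)" by (metis surj_pair)
    then show "p c \<in> inner_windows T k 1"
      using p[of c] c by (auto simp: good_def inner_windows_def)
  qed
  ultimately show ?thesis by (rule card_inj_on_le) (rule finite_inner_windows)
qed

lemma sum_inner_occupancy_le: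
  assumes irr: "irredundant T" and k: "k \<ge> 3"
  shows "(\<Sum>i=1..<k. \<Sum>j=1..<k. occupancy T i j)
    \<le> 3 * (int k - 1)\<^sup>2 - 2 * int (card (T \<inter> {2..<k} \<times> {2..<k}))"
proof -
  let ?I = "{1..<k} \<times> {1..<k}"
  let ?n = "\<lambda>c. int (card (inner_windows T k c))"
  have count: "(\<Sum>(i, j)\<in>?I. of_bool (occupancy T i j = c)) = ?n c" for c
  proof -
    have "?I \<inter> {x. case x of (i, j) \<Rightarrow> occupancy T i j = c} = inner_windows T k c"
      by (auto simp: inner_windows_def)
    then show ?thesis by (simp add: case_prod_unfold)
  qed
  have "(\<Sum>i=1..<k. \<Sum>j=1..<k. occupancy T i j) = (\<Sum>(i, j)\<in>?I. occupancy T i j)"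
    by (rule sum.cartesian_product)
  \<comment> \<open>The weights make a window with three elements neutral and give a loss of two for each element
    alone in its window, one for each pair, and a gain of one for each full window.\<close>
  also have "\<dots> \<le> (\<Sum>(i, j)\<in>?I. 3 - 2 * of_bool (occupancy T i j = 1)
      - of_bool (occupancy T i j = 2) + of_bool (occupancy T i j = 4))"
    by (intro sum_mono) (auto simp: occupancy_def occupied_def of_bool_def)
  also have "\<dots> = 3 * int (card ?I) - 2 * ?n 1 - ?n 2 + ?n 4"
    unfolding count[symmetric]
    by (simp add: case_prod_unfold sum.distrib sum_subtractf sum_distrib_left)
  also have "\<dots> \<le> 3 * (int k - 1)\<^sup>2 - 2 * int (card (T \<inter> {2..<k} \<times> {2..<k}))"
    using card_full_windows_le[OF irr k] card_inner_cells_le[OF irr, of k] k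
    by (simp add: power2_eq_square of_nat_diff)
  finally show ?thesis .
qed

lemma sum_consecutive_pairs:
  fixes f :: "nat \<Rightarrow> int"
  assumes "k \<ge> 1"
  shows "(\<Sum>i=1..<k. f i + f (Suc i)) = 2 * (\<Sum>i=1..k. f i) - f 1 - f k"
  using assms by (induction k rule: dec_induct) auto

lemma sum_split_ends:
  fixes f :: "nat \<Rightarrow> int"
  assumes "k \<ge> 2"
  shows "(\<Sum>i=2..<k. f i) = (\<Sum>i=1..k. f i) - f 1 - f k"
  using assms by (induction k rule: dec_induct) (auto simp: numeral_2_eq_2)

section \<open>The bound for positions and for cards\<close>

text \<open>
  The two counts of incidences are evaluated through the sums \<open>R 1\<close>, \<open>R k\<close>, \<open>C 1\<close>, \<open>C k\<close> over the
  four sides. These count each corner twice, so that \<open>R 1 + R k + C 1 + C k - 4\<close> is the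
  number of elements on the boundary.
\<close>

lemma irredundant_card_bound:
  assumes irr: "irredundant T" and sub: "T \<subseteq> {1..k} \<times> {1..k}" and k: "k \<ge> 3"
    and corners: "(1, 1) \<in> T" "(1, k) \<in> T" "(k, 1) \<in> T" "(k, k) \<in> T"
  shows "6 * int (card T) \<le> 3 * (int k - 1)\<^sup>2 - 12 + 16 * (2 * int (Suc k) div 3)"
proof -
  let ?x = "occupied T"
  define R where "R i = (\<Sum>j=1..k. ?x i j)" for i
  define C where "C j = (\<Sum>i=1..k. ?x i j)" for j
  define N where "N = (\<Sum>i=1..k. R i)"
  have x_corner: "?x 1 1 = 1" "?x 1 k = 1" "?x k 1 = 1" "?x k k = 1"
    using corners by (auto simp: occupied_def)
  have card_rect: "int (card (T \<inter> A \<times> B)) = (\<Sum>i\<in>A. \<Sum>j\<in>B. ?x i j)"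
    if "finite A" "finite B" for A B
  proof -
    have "(\<Sum>i\<in>A. \<Sum>j\<in>B. ?x i j) = (\<Sum>c\<in>A \<times> B. of_bool (c \<in> T))"
      unfolding sum.cartesian_product by (simp add: occupied_def case_prod_unfold)
    also have "\<dots> = int (card (A \<times> B \<inter> T))"
      using that by simp
    finally show ?thesis by (simp add: Int_commute)
  qed
  have card_T: "int (card T) = N"
    using card_rect[of "{1..k}" "{1..k}"] sub by (simp add: N_def R_def Int_absorb2)
  have "int (card (T \<inter> {2..<k} \<times> {2..<k})) = (\<Sum>i=2..<k. R i - ?x i 1 - ?x i k)"
    using sum_split_ends[of k] k by (subst card_rect) (simp_all add: R_def)
  also have "\<dots> = (N - R 1 - R k) - (C 1 - 1 - 1) - (C k - 1 - 1)"
    using k x_corner by (simp add: sum_subtractf sum_split_ends N_def C_def)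
  finally have inner_cells:
    "int (card (T \<inter> {2..<k} \<times> {2..<k})) = N - (R 1 + R k + C 1 + C k) + 4"
    by simp
  have "(\<Sum>i=1..<k. \<Sum>j=1..<k. occupancy T i j)
      = (\<Sum>i=1..<k. (\<Sum>j=1..<k. ?x i j + ?x i (Suc j))
          + (\<Sum>j=1..<k. ?x (Suc i) j + ?x (Suc i) (Suc j)))"
    by (simp add: occupancy_def sum.distrib algebra_simps)
  also have "\<dots> = (\<Sum>i=1..<k. (2 * R i - ?x i 1 - ?x i k)
      + (2 * R (Suc i) - ?x (Suc i) 1 - ?x (Suc i) k))"
    using sum_consecutive_pairs[of k] k unfolding R_def
    by (intro sum.cong refl arg_cong2[of _ _ _ _ "(+)"]) simp_all
  also have "\<dots> = 2 * (\<Sum>i=1..k. 2 * R i - ?x i 1 - ?x i k)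
      - (2 * R 1 - ?x 1 1 - ?x 1 k) - (2 * R k - ?x k 1 - ?x k k)"
    using k by (intro sum_consecutive_pairs) simp
  also have "\<dots> = 4 * N - 2 * (R 1 + R k + C 1 + C k) + 4"
    using x_corner by (simp add: sum_subtractf N_def C_def sum_distrib_left[symmetric])
  finally have inner_occupancy: "(\<Sum>i=1..<k. \<Sum>j=1..<k. occupancy T i j)
      = 4 * N - 2 * (R 1 + R k + C 1 + C k) + 4" .
  have row: "R i \<le> 2 * int (Suc k) div 3" for i
    using line_bound[OF irr sub, of i] by (simp add: R_def)
  have "T\<inverse> \<subseteq> {1..k} \<times> {1..k}" using sub by auto
  then have column: "C j \<le> 2 * int (Suc k) div 3" for j
    using line_bound[OF irredundant_converse[OF irr], of k j] by (simp add: C_def occupied_def)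
  have "6 * N \<le> 3 * (int k - 1)\<^sup>2 - 12 + 4 * (R 1 + R k + C 1 + C k)"
    using sum_inner_occupancy_le[OF irr k] unfolding inner_occupancy inner_cells by simp
  then show ?thesis
    using row[of 1] row[of k] column[of 1] column[of k] unfolding card_T
    by (simp del: of_nat_Suc)
qed

definition positions :: "square set set \<Rightarrow> (nat \<times> nat) set" where
  "positions U = {(a, b). block_card a b \<in> U}"

lemma block_card_inject: "block_card a b = block_card c d \<longleftrightarrow> a = c \<and> b = d"
proof
  assume eq: "block_card a b = block_card c d"
  have "(a, b) \<in> block_card a b" "(c, d) \<in> block_card c d" by (simp_all add: block_card_def)
  then have "(a, b) \<in> block_card c d" "(c, d) \<in> block_card a b" by (simp_all only: eq)
  then show "a = c \<and> b = d" by (auto simp: block_card_def)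
qed simp

lemma multiplicity_eq_occupancy:
  assumes "U \<subseteq> range (case_prod block_card)"
  shows "int (multiplicity U (Suc i, Suc j)) = occupancy (positions U) i j"
proof -
  let ?W = "{(i, j), (Suc i, j), (i, Suc j), (Suc i, Suc j)}"
  have covers: "(Suc i, Suc j) \<in> block_card a b \<longleftrightarrow> (a, b) \<in> ?W" for a b
    by (auto simp: block_card_def)
  have "{C \<in> U. (Suc i, Suc j) \<in> C} = case_prod block_card ` (positions U \<inter> ?W)"
  proof (intro equalityI subsetI)
    fix C assume C: "C \<in> {C \<in> U. (Suc i, Suc j) \<in> C}"
    then obtain a b where ab: "C = block_card a b" using assms by auto
    then have "(a, b) \<in> positions U \<inter> ?W" using C covers by (simp add: positions_def)
    then show "C \<in> case_prod block_card ` (positions U \<inter> ?W)" using ab by force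
  next
    fix C assume "C \<in> case_prod block_card ` (positions U \<inter> ?W)"
    then obtain a b where "C = block_card a b" "(a, b) \<in> positions U" "(a, b) \<in> ?W" by auto
    then show "C \<in> {C \<in> U. (Suc i, Suc j) \<in> C}" using covers by (simp add: positions_def)
  qed
  moreover have "inj_on (case_prod block_card) (positions U \<inter> ?W)"
    by (auto simp: inj_on_def block_card_inject)
  ultimately have "int (multiplicity U (Suc i, Suc j)) = int (card (positions U \<inter> ?W))"
    by (simp add: multiplicity_def card_image)
  also have "\<dots> = (\<Sum>c\<in>?W. of_bool (c \<in> positions U))"
    by (simp add: Int_commute)
  also have "\<dots> = occupancy (positions U) i j"
    by (simp add: occupancy_def occupied_def)
  finally show ?thesis .
qed

lemma irredundant_cover_bound:
  assumes cover: "irredundant_cover m U" and m: "m \<ge> 4"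
  shows "6 * int (card U) \<le> 3 * (int m)\<^sup>2 - 12 * int m + 16 * (2 * int m div 3)"
proof -
  define k where "k = m - 1"
  have k: "k \<ge> 3" "m = Suc k" using m by (auto simp: k_def)
  let ?T = "positions U"
  have U: "U \<subseteq> all_cards m" using cover by (simp add: irredundant_cover_def configuration_def)
  have range: "U \<subseteq> range (case_prod block_card)"
    using U unfolding all_cards_def by (auto simp: image_iff)
  have sub: "?T \<subseteq> {1..k} \<times> {1..k}"
    using U unfolding positions_def all_cards_def k_def by (auto simp: block_card_inject)
  have card: "card U = card ?T"
  proof -
    have "U = case_prod block_card ` ?T" using range by (auto simp: positions_def)
    moreover have "inj_on (case_prod block_card) ?T"
      by (auto simp: inj_on_def block_card_inject)
    ultimately show ?thesis by (metis card_image)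
  qed
  have irr: "irredundant ?T"
    unfolding irredundant_def
  proof (intro allI impI)
    fix a b assume ab: "(a, b) \<in> ?T"
    then obtain x where x: "private_square U (block_card a b) x"
      using cover by (auto simp: positions_def irredundant_cover_def)
    have "1 \<le> a" "1 \<le> b" using ab sub by auto
    then obtain i j where ij: "x = (Suc i, Suc j)" "a \<in> {i, Suc i}" "b \<in> {j, Suc j}"
      using x by (cases a; cases b) (auto simp: private_square_def block_card_def)
    then have "occupancy ?T i j = 1"
      using x multiplicity_eq_occupancy[OF range, of i j] by (simp add: private_square_def)
    then show "\<exists>i j. a \<in> {i, Suc i} \<and> b \<in> {j, Suc j} \<and> occupancy ?T i j = 1"
      using ij by blast
  qed
  \<comment> \<open>Only one card can cover a corner square, so all four corner positions are occupied.\<close>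
  have covered: "occupancy ?T i j \<ge> 1" if "i \<le> k" "j \<le> k" for i j
    using cover that k multiplicity_eq_occupancy[OF range, of i j]
    by (force simp: irredundant_cover_def grid_def)
  have outside: "(0, j) \<notin> ?T" "(i, 0) \<notin> ?T" "(Suc k, j) \<notin> ?T" "(i, Suc k) \<notin> ?T" for i j
    using sub by auto
  have corners: "(1, 1) \<in> ?T" "(1, k) \<in> ?T" "(k, 1) \<in> ?T" "(k, k) \<in> ?T"
    using covered[of 0 0] covered[of 0 k] covered[of k 0] covered[of k k] outside
    by (auto simp: occupancy_def occupied_def of_bool_def split: if_splits)
  show ?thesis
    using irredundant_card_bound[OF irr sub k(1) corners] card k(2)
    by (simp add: power2_eq_square algebra_simps)
qed

theorem theorem3p13:
  fixes m :: nat
  assumes "m \<ge> 4"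
  shows "int (max_cover_size m) \<le> \<lfloor>(3 * real m ^ 2 - 12 * real m + 16 * real_of_int \<lfloor>2 * real m / 3\<rfloor>) / 6\<rfloor>
       \<and> real (max_cover_size m) \<le> 1 / 2 * real m ^ 2 - 2 * real m / 9"
proof -
  let ?F = "max_cover_size m"
  obtain U where "irredundant_cover m U" "card U = ?F"
    using max_cover_size_attained[of m] assms by auto
  then have "6 * int ?F \<le> 3 * (int m)\<^sup>2 - 12 * int m + 16 * (2 * int m div 3)"
    using irredundant_cover_bound assms by metis
  moreover have floor: "\<lfloor>2 * real m / 3\<rfloor> = 2 * int m div 3"
    using floor_divide_of_int_eq[of "2 * int m" 3, where 'a = real] by simp
  ultimately have "real_of_int (6 * int ?F)
      \<le> real_of_int (3 * (int m)\<^sup>2 - 12 * int m + 16 * \<lfloor>2 * real m / 3\<rfloor>)"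
    by (simp only: of_int_le_iff)
  then have bound: "6 * real ?F \<le> 3 * real m ^ 2 - 12 * real m + 16 * real_of_int \<lfloor>2 * real m / 3\<rfloor>"
    by simp
  have "real_of_int \<lfloor>2 * real m / 3\<rfloor> \<le> 2 * real m / 3"
    by (rule of_int_floor_le)
  with bound have "real ?F \<le> 1 / 2 * real m ^ 2 - 2 * real m / 9"
    by simp
  moreover have "int ?F \<le> \<lfloor>(3 * real m ^ 2 - 12 * real m + 16 * real_of_int \<lfloor>2 * real m / 3\<rfloor>) / 6\<rfloor>"
    using bound by (simp add: le_floor_iff)
  ultimately show ?thesis by blast
qed

end
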